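(* Let $\Psi$ be a weighted directed graph with finite vertex set ${\tt N}$, let $\aleph$ be a partition of ${\tt N}$ by which $\Psi$ is tree-divisible, let $F'\in{\cal F}^k(\Psi|\aleph)$ and let $F$ be a principal of $F'$. Then $F$ is a minimal principal of $F'$ if and only if all of the following hold: (i) $\Upsilon^F_{\tt Z}=\lambda^\bullet_{\tt Z}$ for every ${\tt Z}\in\aleph$ containing a root of $F$; (ii) $\Upsilon^F_{\tt X}=\lambda_{\tt XY}$ for every arc $({\tt X},{\tt Y})$ of $F'$; (iii) $\Upsilon^{F|_{\tt X}}=\lambda^{\bullet x}_{\tt X}$ for every ${\tt X}\in\aleph$, where $x$ is the root of the tree $F|_{\tt X}$.
   Context: $\Psi$ has real arc weights $\psi_{ij}$. An entering forest is a directed graph in which at most one arc leaves each vertex and there are no directed cycles; its components are entering trees, whose root is the unique vertex with no outgoing arc. ${\cal F}^k(G)$ is the set of spanning entering forests of $G$ with exactly $k$ trees. For a subgraph $G$ of $\Psi$ and ${\tt D}\subseteq{\tt N}$, $\Upsilon^G_{\tt D}=\sum_{(i,j)\in{\tt A}G,\ i\in{\tt D}}\psi_{ij}$ (arcs with tail in ${\tt D}$, head arbitrary), $\Upsilon^G=\Upsilon^G_{\tt N}$; $G|_{\tt D}$ is the induced subgraph. For a spanning subgraph $G$ of $\Psi$ and ${\tt D}\subseteq{\tt N}$: ${\cal T}^{\bullet q}_{\tt D}(G)$ is the set of entering trees in $G$ with vertex set ${\tt D}$ and root $q\in{\tt D}$, ${\cal T}^\bullet_{\tt D}(G)=\bigcup_{q\in{\tt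 D}}{\cal T}^{\bullet q}_{\tt D}(G)$, $\lambda^{\bullet q}_{\tt D}(G)=\min_{T\in{\cal T}^{\bullet q}_{\tt D}(G)}\Upsilon^T$, $\lambda^\bullet_{\tt D}(G)=\min_q\lambda^{\bullet q}_{\tt D}(G)$; ${\cal T}^\circ_{\tt D}(G)$ is the set of entering trees $T\subseteq G$ with ${\tt D}\subset{\tt V}T$, $|{\tt V}T|=|{\tt D}|+1$, $T|_{\tt D}\in{\cal T}^\bullet_{\tt D}(G)$. For distinct ${\tt X},{\tt Y}\in\aleph$, ${\cal T}_{\tt XY}(G)$ is the set of $T\in{\cal T}^\circ_{\tt X}(G)$ with root in ${\tt Y}$ and $\lambda_{\tt XY}(G)=\min_{T\in{\cal T}_{\tt XY}(G)}\Upsilon^T$. When $G=\Psi$ the argument is omitted. $G$ is tree-divisible by $\aleph$ if ${\cal T}^\bullet_{\tt X}(G)\ne\emptyset$ for all ${\tt X}\in\aleph$. The splitting $G|\aleph=G^\aleph$ of a tree-divisible $G$ has vertex set $\aleph$ and an arc $({\tt X},{\tt Y})$, ${\tt X}\neq{\tt Y}$, iff ${\cal T}_{\tt XY}(G)\ne\emptyset$, of weight $\lambda_{\tt XY}(G)-\lambda^\bullet_{\tt X}(G)$. A tree-divisible $F\in{\cal F}^k(\Psi)$ is a principal of a spanning entering forest $F'$ of $\Psi|\aleph$ if the arc set of $F'$ equals that of $F^\aleph$. A minimal principal of $F'$ is a principal $F$ of $F'$ with $\Upsilon^F$ minimal among all principals of $F'$. *)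

theory Defs
  imports
    "Graph_Theory.Graph_Theory"
    "HOL-Library.Extended_Real"
    "HOL-Library.Disjoint_Sets"
begin

text \<open>
  Digraphs without parallel arcs are of type \<^typ>\<open>'a pair_pre_digraph\<close>; the arc weights are kept
  apart from the graph, as a function \<open>\<psi>\<close> on pairs of vertices that all subgraphs share. The
  coercion \<^const>\<open>with_proj\<close> to general digraphs is mostly left implicit. Note that the library
  predicate \<^const>\<open>forest\<close> forbids exactly the directed cycles, loops included, and that
  \<^const>\<open>Digraph_Component.connected\<close> is weak connectedness.
\<close>

definition entering_forest :: "'a pair_pre_digraph \<Rightarrow> bool" where
  "entering_forest G \<longleftrightarrow>
     pair_fin_digraph G \<and> (\<forall>v \<in> pverts G. out_degree G v \<le> 1) \<and> forest G"

definition entering_tree :: "'a pair_pre_digraph \<Rightarrow> bool" where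
  "entering_tree T \<longleftrightarrow> entering_forest T \<and> Digraph_Component.connected T"

definition roots :: "'a pair_pre_digraph \<Rightarrow> 'a set" where
  "roots G = {q \<in> pverts G. out_arcs G q = {}}"

definition tree_root :: "'a pair_pre_digraph \<Rightarrow> 'a" where
  "tree_root T = (THE q. q \<in> roots T)"

definition tree_components :: "'a pair_pre_digraph \<Rightarrow> ('a, 'a \<times> 'a) pre_digraph set" where
  "tree_components G = {H. pre_digraph.max_subgraph G Digraph_Component.connected H}"

definition spanning_forests :: "nat \<Rightarrow> 'a pair_pre_digraph \<Rightarrow> 'a pair_pre_digraph set" where
  "spanning_forests k G = {F. spanning (with_proj F) G \<and> entering_forest F \<and> card (tree_components F) = k}"

definition pinduce :: "'a pair_pre_digraph \<Rightarrow> 'a set \<Rightarrow> 'a pair_pre_digraph" where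
  "pinduce G D = \<lparr>pverts = D, parcs = {(i, j) \<in> parcs G. i \<in> D \<and> j \<in> D}\<rparr>"

definition Upsilon_on :: "('a \<times> 'a) weight_fun \<Rightarrow> 'a pair_pre_digraph \<Rightarrow> 'a set \<Rightarrow> real" where
  "Upsilon_on \<psi> G D = (\<Sum>(i, j) \<in> {(i, j) \<in> parcs G. i \<in> D}. \<psi> (i, j))"

definition Upsilon :: "('a \<times> 'a) weight_fun \<Rightarrow> 'a pair_pre_digraph \<Rightarrow> real" where
  "Upsilon \<psi> G = Upsilon_on \<psi> G (pverts G)"

definition trees_root :: "'a pair_pre_digraph \<Rightarrow> 'a set \<Rightarrow> 'a \<Rightarrow> 'a pair_pre_digraph set" where
  "trees_root G D q = {T. subgraph (with_proj T) G \<and> entering_tree T \<and> pverts T = D \<and> tree_root T = q}"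

definition trees :: "'a pair_pre_digraph \<Rightarrow> 'a set \<Rightarrow> 'a pair_pre_digraph set" where
  "trees G D = (\<Union>q \<in> D. trees_root G D q)"

definition trees_out :: "'a pair_pre_digraph \<Rightarrow> 'a set \<Rightarrow> 'a pair_pre_digraph set" where
  "trees_out G D = {T. subgraph (with_proj T) G \<and> entering_tree T \<and> D \<subset> pverts T \<and>
     card (pverts T) = card D + 1 \<and> pinduce T D \<in> trees G D}"

definition trees_between ::
    "'a pair_pre_digraph \<Rightarrow> 'a set \<Rightarrow> 'a set \<Rightarrow> 'a pair_pre_digraph set" where
  "trees_between G X Y = {T \<in> trees_out G X. tree_root T \<in> Y}"

text \<open>
  The minima below range over finite families as soon as the digraph is finite. They are taken in
  the extended reals, so that the minimum of an empty family is \<open>\<infinity>\<close> and drops out of the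
  minimum over all roots.
\<close>

definition lambda_root ::
    "('a \<times> 'a) weight_fun \<Rightarrow> 'a pair_pre_digraph \<Rightarrow> 'a set \<Rightarrow> 'a \<Rightarrow> ereal" where
  "lambda_root \<psi> G D q = (INF T \<in> trees_root G D q. ereal (Upsilon \<psi> T))"

definition lambda_tree :: "('a \<times> 'a) weight_fun \<Rightarrow> 'a pair_pre_digraph \<Rightarrow> 'a set \<Rightarrow> ereal" where
  "lambda_tree \<psi> G D = (INF q \<in> D. lambda_root \<psi> G D q)"

definition lambda_between ::
    "('a \<times> 'a) weight_fun \<Rightarrow> 'a pair_pre_digraph \<Rightarrow> 'a set \<Rightarrow> 'a set \<Rightarrow> ereal" where
  "lambda_between \<psi> G X Y = (INF T \<in> trees_between G X Y. ereal (Upsilon \<psi> T))"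

definition tree_divisible :: "'a pair_pre_digraph \<Rightarrow> 'a set set \<Rightarrow> bool" where
  "tree_divisible G P \<longleftrightarrow> (\<forall>X \<in> P. trees G X \<noteq> {})"

definition splitting :: "'a pair_pre_digraph \<Rightarrow> 'a set set \<Rightarrow> 'a set pair_pre_digraph" where
  "splitting G P = \<lparr>pverts = P,
     parcs = {(X, Y). X \<in> P \<and> Y \<in> P \<and> X \<noteq> Y \<and> trees_between G X Y \<noteq> {}}\<rparr>"

text \<open>
  Both terms of the difference are finite on the arcs of the splitting of a tree-divisible finite
  digraph. The notions below depend only on the arcs of the splitting, not on their weights.
\<close>

definition splitting_weight ::
    "('a \<times> 'a) weight_fun \<Rightarrow> 'a pair_pre_digraph \<Rightarrow> ('a set \<times> 'a set) weight_fun" where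
  "splitting_weight \<psi> G = (\<lambda>(X, Y). real_of_ereal (lambda_between \<psi> G X Y - lambda_tree \<psi> G X))"

definition is_principal ::
    "'a pair_pre_digraph \<Rightarrow> 'a set set \<Rightarrow> 'a set pair_pre_digraph \<Rightarrow> 'a pair_pre_digraph \<Rightarrow> bool" where
  "is_principal \<Psi> P F' F \<longleftrightarrow>
     (\<exists>k. F \<in> spanning_forests k \<Psi>) \<and> tree_divisible F P \<and>
     (\<exists>k. F' \<in> spanning_forests k (splitting \<Psi> P)) \<and>
     parcs F' = parcs (splitting F P)"

definition minimal_principal ::
    "('a \<times> 'a) weight_fun \<Rightarrow> 'a pair_pre_digraph \<Rightarrow> 'a set set \<Rightarrow> 'a set pair_pre_digraph \<Rightarrow>
     'a pair_pre_digraph \<Rightarrow> bool" where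
  "minimal_principal \<psi> \<Psi> P F' F \<longleftrightarrow>
     is_principal \<Psi> P F' F \<and> (\<forall>H. is_principal \<Psi> P F' H \<longrightarrow> Upsilon \<psi> F \<le> Upsilon \<psi> H)"

end

theory Submission
  imports Defs
begin

text \<open>
  A principal of \<open>F'\<close> is obtained by choosing, independently for each block \<open>X\<close>, the arcs leaving the
  vertices of \<open>X\<close>: an entering tree on \<open>X\<close> if \<open>X\<close> is a root of \<open>F'\<close>, and such a tree together with
  one arc from its root into \<open>Y\<close> if \<open>(X, Y)\<close> is an arc of \<open>F'\<close>. The weight is additive over the
  blocks, so a principal is minimal iff every block is minimal, which is (i) and (ii). Condition
  (iii) then follows by exchanging the tree inside a block while keeping its root and outgoing arc.
\<close>

section \<open>Entering forests and trees in terms of the arc relation\<close>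

lemma subgraph_with_proj_iff:
  "subgraph (with_proj H) (with_proj G) \<longleftrightarrow>
     pverts H \<subseteq> pverts G \<and> parcs H \<subseteq> parcs G \<and> pair_wf_digraph G \<and> pair_wf_digraph H"
  by (auto simp: subgraph_def wf_digraph_wp_iff)

lemma pair_wf_digraph_iff: "pair_wf_digraph G \<longleftrightarrow> parcs G \<subseteq> pverts G \<times> pverts G"
  unfolding pair_wf_digraph_def by auto

lemma pair_fin_digraph_iff:
  "pair_fin_digraph G \<longleftrightarrow> finite (pverts G) \<and> parcs G \<subseteq> pverts G \<times> pverts G"
  by (auto simp: pair_fin_digraph_def pair_fin_digraph_axioms_def pair_wf_digraph_iff
      intro: finite_subset)

text \<open>A library \<open>cycle\<close> does not repeat vertices, but every nonempty closed walk
  contains one, so excluding cycles amounts to acyclicity of the arc relation.\<close>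

lemma forest_with_proj_iff:
  assumes "pair_wf_digraph G"
  shows "forest (with_proj G) \<longleftrightarrow> acyclic (parcs G)"
proof -
  interpret pair_wf_digraph G by fact
  have "(\<exists>p. cycle p) \<longleftrightarrow> (\<exists>u p. awalk u p u \<and> p \<noteq> [])"
    using closed_w_imp_cycle by (auto simp: cycle_def closed_w_def)
  also have "\<dots> \<longleftrightarrow> \<not> acyclic (parcs G)"
    using reachable1_awalk by (auto simp: acyclic_def)
  finally show ?thesis by (simp add: forest_def)
qed

lemma entering_forest_iff:
  "entering_forest G \<longleftrightarrow> finite (pverts G) \<and> parcs G \<subseteq> pverts G \<times> pverts G \<and>
     single_valued (parcs G) \<and> acyclic (parcs G)"
proof (cases "pair_fin_digraph G")
  case True
  then interpret pair_fin_digraph G .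
  have "out_degree G v \<le> 1 \<longleftrightarrow> (\<forall>w w'. (v, w) \<in> parcs G \<longrightarrow> (v, w') \<in> parcs G \<longrightarrow> w = w')" for v
  proof -
    \<comment> \<open>Finiteness of the arc set matters: an infinite set of outgoing arcs would have
      cardinality 0.\<close>
    have "out_degree G v \<le> 1 \<longleftrightarrow> (\<forall>a\<in>out_arcs G v. \<forall>b\<in>out_arcs G v. a = b)"
      using pair_finite_arcs by (simp add: out_degree_def out_arcs_def card_le_Suc0_iff_eq)
    then show ?thesis by (auto simp: out_arcs_def)
  qed
  then have "(\<forall>v\<in>pverts G. out_degree G v \<le> 1) \<longleftrightarrow> single_valued (parcs G)"
    using in_arcsD1 unfolding single_valued_def by metis
  with True show ?thesis
    by (simp add: entering_forest_def pair_fin_digraph_iff pair_wf_digraph_iff forest_with_proj_iff)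
qed (auto simp: entering_forest_def pair_fin_digraph_iff)

lemma roots_eq: "roots G = pverts G - Domain (parcs G)"
  by (auto simp: roots_def out_arcs_def)

text \<open>Walking along arcs terminates, since the converse of a finite acyclic relation is
  well-founded, and it can stop only at a root.\<close>

lemma reaches_root:
  assumes "entering_forest G" "v \<in> pverts G"
  shows "\<exists>q\<in>roots G. (v, q) \<in> (parcs G)\<^sup>*"
proof -
  have fin: "finite (parcs G)" and G: "parcs G \<subseteq> pverts G \<times> pverts G" "acyclic (parcs G)"
    using assms by (auto simp: entering_forest_iff intro: finite_subset)
  have "wf ((parcs G)\<inverse>)" by (rule finite_acyclic_wf_converse[OF fin G(2)])
  then show ?thesis using assms(2)
  proof (induction v rule: wf_induct_rule)
    case (less v)
    show ?case
    proof (cases "v \<in> Domain (parcs G)")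
      case True
      then obtain w where "(v, w) \<in> parcs G" by blast
      with less G(1) show ?thesis by (blast intro: converse_rtrancl_into_rtrancl)
    qed (use less in \<open>auto simp: roots_eq\<close>)
  qed
qed

text \<open>Induction along an undirected walk that starts at \<open>q\<close>. Crossing an arc
  backwards prepends it to the directed path to \<open>q\<close>. Crossing an arc forwards follows
  the only arc leaving \<open>u\<close>, hence the first arc of the path from \<open>u\<close> to
  \<open>q\<close>.\<close>

lemma connected_imp_reaches_root:
  assumes "entering_forest G" "Digraph_Component.connected (with_proj G)"
    and "q \<in> roots G" "v \<in> pverts G"
  shows "(v, q) \<in> (parcs G)\<^sup>*"
proof -
  have sv: "single_valued (parcs G)" using assms(1) by (simp add: entering_forest_iff)
  let ?M = "with_proj (mk_symmetric (with_proj G))"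
  have "q \<rightarrow>\<^sup>*\<^bsub>?M\<^esub> v"
    using assms(2-4) by (auto simp: connected_def strongly_connected_def mk_symmetric_def roots_eq)
  then have "(q, v) \<in> (arcs_ends ?M)\<^sup>*" by (rule reachable_rtranclI)
  then show ?thesis
  proof induction
    case (step u v)
    then consider "(u, v) \<in> parcs G" | "(v, u) \<in> parcs G" by (auto simp: mk_symmetric_def)
    then show ?case
    proof cases
      case 1
      with assms(3) have "u \<noteq> q" by (auto simp: roots_eq)
      with step.IH obtain w where "(u, w) \<in> parcs G" "(w, q) \<in> (parcs G)\<^sup>*"
        by (meson converse_rtranclE)
      with 1 sv show ?thesis by (metis single_valuedD)
    next
      case 2
      with step.IH show ?thesis by (rule converse_rtrancl_into_rtrancl[rotated])
    qed
  qed simp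
qed

text \<open>In a connected forest every root reaches every other root, but no arc leaves a root, so
  there is only one. Conversely, if all vertices reach a single root, any two are joined through it
  once arcs are symmetrised.\<close>

lemma entering_tree_iff: "entering_tree G \<longleftrightarrow> entering_forest G \<and> (\<exists>q. roots G = {q})"
proof (cases "entering_forest G")
  case True
  have "Digraph_Component.connected (with_proj G) \<longleftrightarrow> (\<exists>q. roots G = {q})"
  proof
    assume conn: "Digraph_Component.connected (with_proj G)"
    then obtain v where "v \<in> pverts G"
      by (auto simp: connected_def strongly_connected_def mk_symmetric_def)
    with True obtain q where q: "q \<in> roots G" by (blast dest: reaches_root)
    have "p = q" if "p \<in> roots G" for p
    proof -
      have "(p, q) \<in> (parcs G)\<^sup>*"
        using connected_imp_reaches_root[OF True conn q] that by (simp add: roots_eq)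
      with that show ?thesis by (auto simp: roots_eq elim: converse_rtranclE)
    qed
    with q show "\<exists>q. roots G = {q}" by blast
  next
    assume "\<exists>q. roots G = {q}"
    then obtain q where q: "roots G = {q}" ..
    let ?M = "mk_symmetric (with_proj G)"
    interpret pair_wf_digraph G
      using True by (simp add: entering_forest_iff pair_wf_digraph_iff)
    interpret M: pair_wf_digraph ?M by (rule wellformed_mk_symmetric)
    have *: "v \<rightarrow>\<^sup>*\<^bsub>with_proj ?M\<^esub> q" if "v \<in> pverts G" for v
    proof (rule reachable_mk_symmetricI)
      have "(v, q) \<in> (parcs G)\<^sup>*" using reaches_root[OF True that] q by simp
      with that show "v \<rightarrow>\<^sup>*\<^bsub>with_proj G\<^esub> q" by (simp add: reachable_conv')
    qed
    show "Digraph_Component.connected (with_proj G)"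
      unfolding connected_def
    proof (rule strongly_connectedI)
      show "verts (with_proj ?M) \<noteq> {}" using q by (auto simp: mk_symmetric_def roots_eq)
      fix u v assume "u \<in> verts (with_proj ?M)" "v \<in> verts (with_proj ?M)"
      then have "u \<in> pverts G" "v \<in> pverts G" by (simp_all add: mk_symmetric_def)
      then have "u \<rightarrow>\<^sup>*\<^bsub>with_proj ?M\<^esub> q" "v \<rightarrow>\<^sup>*\<^bsub>with_proj ?M\<^esub> q" by (simp_all add: *)
      then show "u \<rightarrow>\<^sup>*\<^bsub>with_proj ?M\<^esub> v"
        using symmetric_mk_symmetric symmetric_reachable M.reachable_trans by metis
    qed
  qed
  with True show ?thesis by (simp add: entering_tree_def)
qed (simp add: entering_tree_def)

section \<open>Entering trees on a given vertex set, and trees with one further vertex\<close>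

lemma tree_root_eq: "roots T = {q} \<Longrightarrow> tree_root T = q"
  by (simp add: tree_root_def)

lemma mem_trees_root_iff:
  "T \<in> trees_root G D q \<longleftrightarrow>
     subgraph (with_proj T) (with_proj G) \<and> entering_forest T \<and> pverts T = D \<and> roots T = {q}"
proof -
  have "(\<exists>p. roots T = {p}) \<and> tree_root T = q \<longleftrightarrow> roots T = {q}"
    using tree_root_eq[of T] by metis
  then show ?thesis by (simp add: trees_root_def entering_tree_iff) metis
qed

lemma mem_trees_iff: "T \<in> trees G D \<longleftrightarrow> (\<exists>q. T \<in> trees_root G D q)"
proof -
  have "q \<in> D" if "T \<in> trees_root G D q" for q
  proof -
    have "q \<in> roots T" "pverts T = D" using that by (simp_all add: mem_trees_root_iff)
    then show ?thesis by (simp add: roots_def)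
  qed
  then show ?thesis unfolding trees_def by blast
qed

text \<open>\<open>F\<close> has no arc between vertices of \<open>T\<close> beyond those of
  \<open>T\<close>: an extra arc from the root \<open>q\<close> would close a cycle, because its
  head reaches \<open>q\<close> inside \<open>T\<close>, and at any other vertex \<open>T\<close>
  already uses the only outgoing arc that \<open>F\<close> allows.\<close>

lemma pinduce_tree:
  assumes "entering_forest F" "entering_forest T" "roots T = {q}" "parcs T \<subseteq> parcs F"
  shows "pinduce F (pverts T) = T"
proof -
  have "(u, v) \<in> parcs T" if uv: "(u, v) \<in> parcs F" "u \<in> pverts T" "v \<in> pverts T" for u v
  proof (cases "u = q")
    case True
    have "(v, q) \<in> (parcs T)\<^sup>*" using reaches_root[OF assms(2) uv(3)] assms(3) by simp
    then have "(v, q) \<in> (parcs F)\<^sup>*" using assms(4) rtrancl_mono by blast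
    with uv(1) True have "(u, u) \<in> (parcs F)\<^sup>+" by (simp add: rtrancl_into_trancl2)
    then show ?thesis using assms(1) by (simp add: entering_forest_iff acyclic_def)
  next
    case False
    with uv(2) assms(3) obtain w where "(u, w) \<in> parcs T" by (auto simp: roots_eq)
    with uv(1) assms(1,4) show ?thesis by (auto simp: entering_forest_iff dest: single_valuedD)
  qed
  moreover have "parcs T \<subseteq> pverts T \<times> pverts T" using assms(2) by (simp add: entering_forest_iff)
  ultimately have "parcs (pinduce F (pverts T)) = parcs T"
    using assms(4) by (auto simp: pinduce_def)
  then show ?thesis by (simp add: pinduce_def)
qed

text \<open>Hence a forest contains at most one tree on a given vertex set, and the root of that
  tree is determined too.\<close>

lemma trees_root_forest:
  assumes "entering_forest F" "S \<in> trees_root F X x"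
  shows "S = pinduce F X"
proof -
  have "entering_forest S" "roots S = {x}" "parcs S \<subseteq> parcs F" "pverts S = X"
    using assms(2) by (simp_all add: mem_trees_root_iff subgraph_with_proj_iff)
  with pinduce_tree[OF assms(1)] show ?thesis by metis
qed

lemma acyclic_insert_sink:
  assumes "acyclic r" "y \<notin> Domain r" "x \<noteq> y"
  shows "acyclic (insert (x, y) r)"
proof -
  have "(y, x) \<notin> r\<^sup>*" using assms(2,3) by (auto elim: converse_rtranclE)
  with assms(1) show ?thesis by simp
qed

text \<open>The root lies in \<open>Y\<close>, so outside \<open>X\<close>, and is therefore the one
  extra vertex. Since \<open>x\<close> is not that root it has an outgoing arc, and this arc cannot
  end in \<open>X\<close>. The resulting decomposition into a tree on \<open>X\<close> and one arc
  lets the two be exchanged separately.\<close>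

lemma trees_between_iff:
  assumes "pair_wf_digraph G" "finite X" "X \<inter> Y = {}" "Y \<subseteq> pverts G"
  shows "T \<in> trees_between G X Y \<longleftrightarrow>
    (\<exists>S x y. S \<in> trees_root G X x \<and> y \<in> Y \<and> (x, y) \<in> parcs G \<and>
       T = \<lparr>pverts = insert y X, parcs = insert (x, y) (parcs S)\<rparr>)" (is "_ \<longleftrightarrow> ?R")
proof
  assume "T \<in> trees_between G X Y"
  then have sub: "subgraph (with_proj T) (with_proj G)" and T: "entering_tree T" "X \<subset> pverts T"
    "card (pverts T) = card X + 1" and S: "pinduce T X \<in> trees G X" and root: "tree_root T \<in> Y"
    by (auto simp: trees_between_def trees_out_def)
  from S obtain x where x: "pinduce T X \<in> trees_root G X x" by (auto simp: mem_trees_iff)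
  let ?y = "tree_root T"
  from T have F: "entering_forest T" and y: "roots T = {?y}"
    by (auto simp: entering_tree_iff tree_root_eq)
  have arcs: "parcs T \<subseteq> pverts T \<times> pverts T" "single_valued (parcs T)"
    using F by (auto simp: entering_forest_iff)
  have yX: "?y \<notin> X" "?y \<in> pverts T" using root assms(3) y by (auto simp: roots_eq)
  have V: "pverts T = insert ?y X"
  proof (rule card_subset_eq[symmetric])
    show "finite (pverts T)" using F by (simp add: entering_forest_iff)
  qed (use T yX assms(2) in auto)
  have rx: "roots (pinduce T X) = {x}" using x by (simp add: mem_trees_root_iff)
  have "x \<in> X" using rx by (auto simp: roots_eq pinduce_def)
  then have "x \<in> pverts T" "x \<notin> roots T" using y yX(1) V by auto
  then obtain w where w: "(x, w) \<in> parcs T" by (auto simp: roots_eq)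
  have "w \<notin> X" using rx w \<open>x \<in> X\<close> by (auto simp: roots_eq pinduce_def)
  with w arcs V have xy: "(x, ?y) \<in> parcs T" by auto
  have "parcs T = insert (x, ?y) (parcs (pinduce T X))"
  proof (intro equalityI subrelI)
    fix u v assume uv: "(u, v) \<in> parcs T"
    then have "u \<in> X" using arcs V y by (auto simp: roots_eq)
    show "(u, v) \<in> insert (x, ?y) (parcs (pinduce T X))"
    proof (cases "v \<in> X")
      case False
      then have "v = ?y" using uv arcs V by auto
      \<comment> \<open>A vertex whose only arc leaves \<open>X\<close> has no arc inside
        \<open>X\<close>, so it must be the root \<open>x\<close> of the induced tree.\<close>
      moreover have "u \<in> roots (pinduce T X)"
        using uv \<open>u \<in> X\<close> False arcs(2) by (auto simp: roots_eq pinduce_def dest: single_valuedD)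
      ultimately show ?thesis using rx by simp
    qed (use uv \<open>u \<in> X\<close> in \<open>simp add: pinduce_def\<close>)
  qed (use xy in \<open>auto simp: pinduce_def\<close>)
  then have "T = \<lparr>pverts = insert ?y X, parcs = insert (x, ?y) (parcs (pinduce T X))\<rparr>"
    using V by (simp add: pair_pre_digraph.equality)
  moreover have "(x, ?y) \<in> parcs G" using xy sub by (auto simp: subgraph_with_proj_iff)
  ultimately show ?R using x root by blast
next
  assume ?R
  then obtain S x y where S: "S \<in> trees_root G X x" and y: "y \<in> Y" "(x, y) \<in> parcs G"
    and T: "T = \<lparr>pverts = insert y X, parcs = insert (x, y) (parcs S)\<rparr>" by blast
  have F: "entering_forest S" and sub: "subgraph (with_proj S) (with_proj G)" and V: "pverts S = X"
    and rS: "roots S = {x}" using S by (auto simp: mem_trees_root_iff)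
  have "y \<notin> X" using y assms(3) by blast
  have arcs: "parcs S \<subseteq> X \<times> X" "single_valued (parcs S)" "acyclic (parcs S)"
    using F V by (auto simp: entering_forest_iff)
  have x: "x \<in> X" "x \<notin> Domain (parcs S)" using rS V by (auto simp: roots_eq)
  have "acyclic (parcs T)"
    unfolding T pair_pre_digraph.simps
    by (rule acyclic_insert_sink) (use arcs x \<open>y \<notin> X\<close> in auto)
  moreover have "single_valued (parcs T)"
    using arcs(2) x(2) by (auto simp: T single_valued_def)
  ultimately have FT: "entering_forest T"
    using arcs x assms(2) by (auto simp: T entering_forest_iff)
  have rT: "roots T = {y}"
    using rS V x arcs(1) \<open>y \<notin> X\<close> by (auto simp: T roots_eq)
  have "pinduce T X = S"
    using arcs(1) V \<open>y \<notin> X\<close> by (auto simp: T pinduce_def intro!: pair_pre_digraph.equality)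
  moreover have "subgraph (with_proj T) (with_proj G)"
    using sub V y x arcs(1) assms(1,4) by (auto simp: subgraph_with_proj_iff pair_wf_digraph_iff T)
  moreover have "X \<subset> pverts T" "card (pverts T) = card X + 1"
    using \<open>y \<notin> X\<close> assms(2) by (auto simp: T)
  moreover have "entering_tree T" using FT rT by (simp add: entering_tree_iff)
  moreover have "S \<in> trees G X" using S by (auto simp: mem_trees_iff)
  moreover have "tree_root T \<in> Y" using y(1) rT by (simp add: tree_root_eq)
  ultimately show "T \<in> trees_between G X Y"
    by (simp add: trees_between_def trees_out_def)
qed

section \<open>Arcs grouped by their tails, and additivity of the weight\<close>

definition tail_arcs :: "'a pair_pre_digraph \<Rightarrow> 'a set \<Rightarrow> ('a \<times> 'a) set" where
  "tail_arcs G D = {(i, j) \<in> parcs G. i \<in> D}"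

lemma Upsilon_on_eq: "Upsilon_on \<psi> G D = sum \<psi> (tail_arcs G D)"
  by (simp add: Upsilon_on_def tail_arcs_def case_prod_unfold)

lemma Upsilon_eq:
  assumes "pair_wf_digraph G"
  shows "Upsilon \<psi> G = sum \<psi> (parcs G)"
proof -
  have "tail_arcs G (pverts G) = parcs G"
    using assms by (auto simp: tail_arcs_def pair_wf_digraph_iff)
  then show ?thesis by (simp add: Upsilon_def Upsilon_on_eq)
qed

text \<open>Each arc has one tail, and that tail lies in exactly one block.\<close>

lemma Upsilon_eq_sum_blocks:
  assumes "pair_fin_digraph G" "partition_on (pverts G) P"
  shows "Upsilon \<psi> G = (\<Sum>X\<in>P. sum \<psi> (tail_arcs G X))"
proof -
  interpret pair_fin_digraph G by fact
  have "parcs G = (\<Union>X\<in>P. tail_arcs G X)"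
    using assms(2) in_arcsD1 by (fastforce simp: tail_arcs_def partition_on_def)
  then have "sum \<psi> (parcs G) = sum \<psi> (\<Union>X\<in>P. tail_arcs G X)" by simp
  also have "\<dots> = (\<Sum>X\<in>P. sum \<psi> (tail_arcs G X))"
  proof (rule sum.UNION_disjoint)
    show "finite P" using finite_elements[OF pair_finite_verts assms(2)] .
    show "\<forall>X\<in>P. finite (tail_arcs G X)"
      using pair_finite_arcs by (auto simp: tail_arcs_def intro: finite_subset)
    show "\<forall>X\<in>P. \<forall>Y\<in>P. X \<noteq> Y \<longrightarrow> tail_arcs G X \<inter> tail_arcs G Y = {}"
      using partition_onD2[OF assms(2)] by (auto simp: tail_arcs_def disjoint_def)
  qed
  finally show ?thesis using Upsilon_eq[OF pair_wf_digraph_axioms] by simp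
qed

text \<open>Arcs with head in \<open>X\<close> belong to the induced graph. An arc leaving
  \<open>X\<close> is the only arc at its tail, which makes the tail a root of the induced graph,
  that is, \<open>x\<close>.\<close>

lemma tail_arcs_tree:
  assumes "entering_forest F" "roots (pinduce F X) = {x}"
  shows "tail_arcs F X = parcs (pinduce F X) \<union> {(i, j) \<in> parcs F. i = x}"
proof (intro equalityI subrelI)
  have "x \<in> roots (pinduce F X)" using assms(2) by simp
  then have "x \<in> X" by (simp add: roots_eq pinduce_def)
  then show "(u, v) \<in> tail_arcs F X"
    if "(u, v) \<in> parcs (pinduce F X) \<union> {(i, j) \<in> parcs F. i = x}" for u v
    using that by (auto simp: tail_arcs_def pinduce_def)
next
  fix u v assume uv: "(u, v) \<in> tail_arcs F X"
  show "(u, v) \<in> parcs (pinduce F X) \<union> {(i, j) \<in> parcs F. i = x}"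
  proof (cases "v \<in> X")
    case False
    with uv assms(1) have "u \<in> roots (pinduce F X)"
      by (auto simp: tail_arcs_def roots_eq pinduce_def entering_forest_iff dest: single_valuedD)
    with uv assms(2) show ?thesis by (simp add: tail_arcs_def)
  qed (use uv in \<open>simp add: tail_arcs_def pinduce_def\<close>)
qed

text \<open>\<open>F\<close> contains only one tree on \<open>X\<close>, so every tree from
  \<open>X\<close> to \<open>Y\<close> in \<open>F\<close> extends it by an arc at its root
  \<open>x\<close>. The arcs of the splitting can thus be read off from the arcs leaving the block
  roots.\<close>

lemma splitting_forest_arc_iff:
  assumes F: "entering_forest F" and P: "partition_on (pverts F) P"
    and "X \<in> P" and x: "S \<in> trees_root F X x"
  shows "(X, Y) \<in> parcs (splitting F P) \<longleftrightarrow> Y \<in> P \<and> X \<noteq> Y \<and> (\<exists>y\<in>Y. (x, y) \<in> parcs F)"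
proof -
  have wf: "pair_wf_digraph F" using F by (simp add: entering_forest_iff pair_wf_digraph_iff)
  have fin: "finite X" using F P \<open>X \<in> P\<close>
    by (auto simp: entering_forest_iff partition_on_def intro: finite_subset)
  have uniq: "x' = x" if "S' \<in> trees_root F X x'" for S' x'
  proof -
    have "S' = S" using trees_root_forest[OF F that] trees_root_forest[OF F x] by simp
    then show ?thesis using that x by (simp add: mem_trees_root_iff)
  qed
  have "trees_between F X Y \<noteq> {} \<longleftrightarrow> (\<exists>y\<in>Y. (x, y) \<in> parcs F)" if "Y \<in> P" "X \<noteq> Y"
  proof -
    have XY: "X \<inter> Y = {}" "Y \<subseteq> pverts F"
      using P \<open>X \<in> P\<close> that by (auto simp: partition_on_def disjoint_def)
    show ?thesis
      unfolding ex_in_conv[symmetric] trees_between_iff[OF wf fin XY] using x uniq by blast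
  qed
  then show ?thesis using \<open>X \<in> P\<close> by (auto simp: splitting_def)
qed

text \<open>The candidate belongs to the family, so equality with the infimum means being a minimum.
  Conditions (i) to (iii) are compared with real inequalities in this way.\<close>

lemma ereal_eq_INF_iff:
  assumes "T\<^sub>0 \<in> S"
  shows "ereal (g T\<^sub>0) = (INF T\<in>S. ereal (g T)) \<longleftrightarrow> (\<forall>T\<in>S. g T\<^sub>0 \<le> g T)"
proof
  assume eq: "ereal (g T\<^sub>0) = (INF T\<in>S. ereal (g T))"
  show "\<forall>T\<in>S. g T\<^sub>0 \<le> g T"
  proof
    fix T assume "T \<in> S"
    then have "ereal (g T\<^sub>0) \<le> ereal (g T)" unfolding eq by (rule INF_lower)
    then show "g T\<^sub>0 \<le> g T" by simp
  qed
next
  assume "\<forall>T\<in>S. g T\<^sub>0 \<le> g T"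
  with assms show "ereal (g T\<^sub>0) = (INF T\<in>S. ereal (g T))"
    by (intro antisym INF_greatest INF_lower) auto
qed

lemma lambda_tree_eq: "lambda_tree \<psi> G D = (INF T\<in>trees G D. ereal (Upsilon \<psi> T))"
  unfolding lambda_tree_def lambda_root_def trees_def
  by (intro antisym INF_greatest) (auto intro: INF_lower2 INF_lower)

section \<open>Principals as independent choices of arcs in the blocks\<close>

locale divided_digraph =
  fixes \<Psi> :: "'a pair_pre_digraph" and P :: "'a set set" and F' :: "'a set pair_pre_digraph"
  assumes fin: "pair_fin_digraph \<Psi>"
    and part: "partition_on (pverts \<Psi>) P"
    and forest': "entering_forest F'"
    and verts': "pverts F' = P"
    and arcs': "parcs F' \<subseteq> parcs (splitting \<Psi> P)"
begin

text \<open>The sets of arcs with tail in \<open>X\<close> that a principal of \<open>F'\<close> can have.\<close>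

definition block_arcs :: "'a set \<Rightarrow> ('a \<times> 'a) set set" where
  "block_arcs X = {parcs S |S. S \<in> trees \<Psi> X \<and> X \<notin> Domain (parcs F')} \<union>
     {parcs T |T Y. (X, Y) \<in> parcs F' \<and> T \<in> trees_between \<Psi> X Y}"

lemma wf: "pair_wf_digraph \<Psi>"
  using fin by (simp add: pair_fin_digraph_def)

lemma finite_block: "X \<in> P \<Longrightarrow> finite X"
  using fin part by (auto simp: pair_fin_digraph_iff partition_on_def intro: finite_subset)

lemma block_subset: "X \<in> P \<Longrightarrow> X \<subseteq> pverts \<Psi>"
  using part by (auto simp: partition_on_def)

lemma block_unique: "X \<in> P \<Longrightarrow> Y \<in> P \<Longrightarrow> v \<in> X \<Longrightarrow> v \<in> Y \<Longrightarrow> X = Y"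
  using part by (auto simp: partition_on_def disjoint_def)

lemma arc'D:
  assumes "(X, Y) \<in> parcs F'"
  shows "X \<in> P" "Y \<in> P" "X \<noteq> Y" "X \<inter> Y = {}"
  using assms arcs' block_unique by (auto simp: splitting_def)

lemma arc'_unique: "(X, Y) \<in> parcs F' \<Longrightarrow> (X, Z) \<in> parcs F' \<Longrightarrow> Y = Z"
  using forest' by (auto simp: entering_forest_iff dest: single_valuedD)

lemma trees_between_arc'_iff:
  assumes "(X, Y) \<in> parcs F'"
  shows "T \<in> trees_between \<Psi> X Y \<longleftrightarrow>
    (\<exists>S x y. S \<in> trees_root \<Psi> X x \<and> y \<in> Y \<and> (x, y) \<in> parcs \<Psi> \<and>
       T = \<lparr>pverts = insert y X, parcs = insert (x, y) (parcs S)\<rparr>)"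
  using arc'D[OF assms] trees_between_iff[OF wf finite_block _ block_subset] by blast

text \<open>Gives both kinds of block a common form: a tree on \<open>X\<close> and, if
  \<open>X\<close> has an outgoing arc in \<open>F'\<close>, one more arc at the root of the
  tree.\<close>

lemma mem_block_arcs_iff:
  "A \<in> block_arcs X \<longleftrightarrow> (\<exists>S x. S \<in> trees_root \<Psi> X x \<and>
     (X \<notin> Domain (parcs F') \<and> A = parcs S \<or>
      (\<exists>Y y. (X, Y) \<in> parcs F' \<and> y \<in> Y \<and> (x, y) \<in> parcs \<Psi> \<and> A = insert (x, y) (parcs S))))"
    (is "_ \<longleftrightarrow> ?R")
proof
  assume "A \<in> block_arcs X"
  then consider S where "S \<in> trees \<Psi> X" "X \<notin> Domain (parcs F')" "A = parcs S"
    | T Y where "(X, Y) \<in> parcs F'" "T \<in> trees_between \<Psi> X Y" "A = parcs T"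
    unfolding block_arcs_def by blast
  then show ?R
  proof cases
    case 1
    then show ?thesis by (auto simp: mem_trees_iff)
  next
    case 2
    then obtain S x y where "S \<in> trees_root \<Psi> X x" "y \<in> Y" "(x, y) \<in> parcs \<Psi>"
      "T = \<lparr>pverts = insert y X, parcs = insert (x, y) (parcs S)\<rparr>"
      using trees_between_arc'_iff by blast
    with 2 show ?thesis by auto
  qed
next
  assume ?R
  then obtain S x where S: "S \<in> trees_root \<Psi> X x"
    and "X \<notin> Domain (parcs F') \<and> A = parcs S \<or>
      (\<exists>Y y. (X, Y) \<in> parcs F' \<and> y \<in> Y \<and> (x, y) \<in> parcs \<Psi> \<and> A = insert (x, y) (parcs S))"
    by blast
  then consider "X \<notin> Domain (parcs F')" "A = parcs S"
    | Y y where "(X, Y) \<in> parcs F'" "y \<in> Y" "(x, y) \<in> parcs \<Psi>" "A = insert (x, y) (parcs S)"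
    by blast
  then show "A \<in> block_arcs X"
  proof cases
    case 1
    with S show ?thesis by (auto simp: block_arcs_def mem_trees_iff)
  next
    case 2
    let ?T = "\<lparr>pverts = insert y X, parcs = insert (x, y) (parcs S)\<rparr>"
    have "?T \<in> trees_between \<Psi> X Y" using S 2 trees_between_arc'_iff by blast
    moreover have "A = parcs ?T" using 2 by simp
    ultimately show ?thesis using 2(1) unfolding block_arcs_def by blast
  qed
qed

text \<open>The number of trees is existentially quantified, hence no constraint, and the locale
  assumptions already make \<open>F'\<close> a spanning forest of the splitting.\<close>

lemma is_principal_iff:
  "is_principal \<Psi> P F' F \<longleftrightarrow> entering_forest F \<and> pverts F = pverts \<Psi> \<and> parcs F \<subseteq> parcs \<Psi> \<and>
     tree_divisible F P \<and> parcs F' = parcs (splitting F P)"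
proof -
  have "(\<exists>k. F \<in> spanning_forests k \<Psi>) \<longleftrightarrow>
      entering_forest F \<and> pverts F = pverts \<Psi> \<and> parcs F \<subseteq> parcs \<Psi>"
    using wf by (auto simp: spanning_forests_def spanning_def subgraph_with_proj_iff
        entering_forest_iff pair_wf_digraph_iff)
  moreover have "\<exists>k. F' \<in> spanning_forests k (splitting \<Psi> P)"
  proof -
    have "pair_wf_digraph (splitting \<Psi> P)" by (auto simp: pair_wf_digraph_iff splitting_def)
    moreover have "pair_wf_digraph F'"
      using forest' by (simp add: entering_forest_iff pair_wf_digraph_iff)
    ultimately show ?thesis
      using forest' verts' arcs'
      by (simp add: spanning_forests_def spanning_def subgraph_with_proj_iff) (simp add: splitting_def)
  qed
  ultimately show ?thesis by (simp add: is_principal_def)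
qed

text \<open>The cases are whether the root \<open>x\<close> of the tree on \<open>X\<close> has an
  outgoing arc in \<open>F\<close>. If it has none, \<open>x\<close> is a root of \<open>F\<close>.
  If it has one, the arc leaves \<open>X\<close> and yields an arc of \<open>F'\<close>; no other
  vertex of \<open>X\<close> can be a root of \<open>F\<close>, as it would be a second root of the
  induced tree.\<close>

lemma principal_block:
  assumes "is_principal \<Psi> P F' F" "X \<in> P"
  obtains x where "pinduce F X \<in> trees_root \<Psi> X x" "X \<notin> Domain (parcs F')" "x \<in> roots F"
      "tail_arcs F X = parcs (pinduce F X)"
  | x Y y where "pinduce F X \<in> trees_root \<Psi> X x" "(X, Y) \<in> parcs F'" "y \<in> Y" "(x, y) \<in> parcs \<Psi>"
      "X \<inter> roots F = {}" "tail_arcs F X = insert (x, y) (parcs (pinduce F X))"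
proof -
  have F: "entering_forest F" and V: "pverts F = pverts \<Psi>" and A: "parcs F \<subseteq> parcs \<Psi>"
    and div: "tree_divisible F P" and F': "parcs F' = parcs (splitting F P)"
    using assms(1) by (simp_all add: is_principal_iff)
  have partF: "partition_on (pverts F) P" using part V by simp
  from div assms(2) obtain S x where "S \<in> trees_root F X x"
    unfolding tree_divisible_def ex_in_conv[symmetric] mem_trees_iff by blast
  with trees_root_forest[OF F] have x: "pinduce F X \<in> trees_root F X x" by metis
  then have S: "pinduce F X \<in> trees_root \<Psi> X x" and rx: "roots (pinduce F X) = {x}"
    using A V wf by (auto simp: mem_trees_root_iff subgraph_with_proj_iff)
  have "x \<in> roots (pinduce F X)" using rx by simp
  then have xX: "x \<in> X" "\<And>v. (x, v) \<in> parcs F \<Longrightarrow> v \<notin> X" by (auto simp: roots_eq pinduce_def)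
  have arc: "(X, Y) \<in> parcs F' \<longleftrightarrow> Y \<in> P \<and> X \<noteq> Y \<and> (\<exists>y\<in>Y. (x, y) \<in> parcs F)" for Y
    unfolding F' by (rule splitting_forest_arc_iff[OF F partF assms(2) x])
  have tail: "tail_arcs F X = parcs (pinduce F X) \<union> {(i, j) \<in> parcs F. i = x}"
    by (rule tail_arcs_tree[OF F rx])
  show thesis
  proof (cases "x \<in> Domain (parcs F)")
    case False
    then have "X \<notin> Domain (parcs F')" using arc by blast
    moreover have "x \<in> roots F" using False xX V block_subset[OF assms(2)] by (auto simp: roots_eq)
    moreover have "tail_arcs F X = parcs (pinduce F X)" using tail False by auto
    ultimately show ?thesis using that(1) S by blast
  next
    case True
    then obtain y where y: "(x, y) \<in> parcs F" by blast
    then have "y \<in> pverts \<Psi>" using F V by (auto simp: entering_forest_iff)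
    then obtain Y where Y: "Y \<in> P" "y \<in> Y" using part by (auto simp: partition_on_def)
    then have "(X, Y) \<in> parcs F'" using arc y xX(2) by blast
    moreover have "X \<inter> roots F = {}"
    proof -
      have "q \<in> roots (pinduce F X)" if "q \<in> X" "q \<in> roots F" for q
        using that by (auto simp: roots_eq pinduce_def)
      then have "X \<inter> roots F \<subseteq> {x}" using rx by blast
      then show ?thesis using True by (auto simp: roots_eq)
    qed
    moreover have "tail_arcs F X = insert (x, y) (parcs (pinduce F X))"
      using tail y F by (auto simp: entering_forest_iff dest: single_valuedD)
    ultimately show ?thesis using that(2) S Y y A by blast
  qed
qed

lemma tail_arcs_principal:
  assumes "is_principal \<Psi> P F' F" "X \<in> P"
  shows "tail_arcs F X \<in> block_arcs X"
  using assms
proof (cases rule: principal_block)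
  case 1
  then show ?thesis unfolding mem_block_arcs_iff by blast
next
  case 2
  then show ?thesis unfolding mem_block_arcs_iff by blast
qed

text \<open>Converse of \<open>tail_arcs_principal\<close>: choices made independently in the blocks
  always fit together. The second claim makes the weight of the assembled graph computable block by
  block.\<close>

lemma principal_of_blocks:
  assumes f: "\<And>X. X \<in> P \<Longrightarrow> f X \<in> block_arcs X"
  defines "H \<equiv> \<lparr>pverts = pverts \<Psi>, parcs = (\<Union>X\<in>P. f X)\<rparr>"
  shows "is_principal \<Psi> P F' H" and "X \<in> P \<Longrightarrow> tail_arcs H X = f X"
proof -
  have "\<forall>X\<in>P. \<exists>S x. S \<in> trees_root \<Psi> X x \<and> (X \<notin> Domain (parcs F') \<and> f X = parcs S \<or>
      (\<exists>Y y. (X, Y) \<in> parcs F' \<and> y \<in> Y \<and> (x, y) \<in> parcs \<Psi> \<and> f X = insert (x, y) (parcs S)))"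
    using f by (simp add: mem_block_arcs_iff)
  then obtain S x where S: "\<And>X. X \<in> P \<Longrightarrow> S X \<in> trees_root \<Psi> X (x X)"
    and fS: "\<And>X. X \<in> P \<Longrightarrow> X \<notin> Domain (parcs F') \<and> f X = parcs (S X) \<or>
      (\<exists>Y y. (X, Y) \<in> parcs F' \<and> y \<in> Y \<and> (x X, y) \<in> parcs \<Psi> \<and>
        f X = insert (x X, y) (parcs (S X)))"
    by metis
  have SX: "entering_forest (S X)" "pverts (S X) = X" "roots (S X) = {x X}"
    "parcs (S X) \<subseteq> parcs \<Psi>" if "X \<in> P" for X
    using S[OF that] by (simp_all add: mem_trees_root_iff subgraph_with_proj_iff)
  have Sarcs: "parcs (S X) \<subseteq> X \<times> X" "single_valued (parcs (S X))" "acyclic (parcs (S X))"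
    if "X \<in> P" for X
    using SX(1,2)[OF that] by (simp_all add: entering_forest_iff)
  have xX: "x X \<in> X" "x X \<notin> Domain (parcs (S X))" if "X \<in> P" for X
  proof -
    have "x X \<in> roots (S X)" using SX[OF that] by simp
    then show "x X \<in> X" "x X \<notin> Domain (parcs (S X))" using SX[OF that] by (simp_all add: roots_eq)
  qed
  have Sf: "parcs (S X) \<subseteq> f X" if "X \<in> P" for X using fS[OF that] by blast
  have f\<Psi>: "f X \<subseteq> parcs \<Psi>" if "X \<in> P" for X using fS[OF that] SX(4)[OF that] by auto
  have f_arc: "u \<in> X \<and> ((u, v) \<in> parcs (S X) \<or> u = x X \<and> (\<exists>Y. (X, Y) \<in> parcs F' \<and> v \<in> Y))"
    if "X \<in> P" "(u, v) \<in> f X" for X u v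
    using fS[OF that(1)] that(2) xX(1)[OF that(1)] Sarcs(1)[OF that(1)] by auto
  have f_sv: "v = w" if "X \<in> P" "(u, v) \<in> f X" "(u, w) \<in> f X" for X u v w
    using fS[OF that(1)] that(2,3) xX(2)[OF that(1)] Sarcs(2)[OF that(1)]
    by (auto dest: single_valuedD)
  \<comment> \<open>Arcs of \<open>f Z\<close> have their tails in \<open>Z\<close> and blocks are
    disjoint, so the tail of an arc tells which block contributed it.\<close>
  have HX: "(u, v) \<in> f X" if uv: "(u, v) \<in> parcs H" and X: "u \<in> X" "X \<in> P" for u v X
  proof -
    obtain Z where Z: "Z \<in> P" "(u, v) \<in> f Z" using uv by (auto simp: H_def)
    with f_arc[OF Z] have "Z = X" using block_unique X by blast
    with Z show ?thesis by simp
  qed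
  have fH: "f X \<subseteq> parcs H" if "X \<in> P" for X using that by (auto simp: H_def)
  show tail: "tail_arcs H X = f X" if "X \<in> P" for X
    using HX[OF _ _ that] fH[OF that] f_arc[OF that] by (auto simp: tail_arcs_def)
  have H\<Psi>: "parcs H \<subseteq> parcs \<Psi>" using f\<Psi> by (auto simp: H_def)
  then have Hwf: "parcs H \<subseteq> pverts H \<times> pverts H" using wf by (auto simp: pair_wf_digraph_iff H_def)
  have block: "\<exists>X\<in>P. u \<in> X" if "u \<in> pverts \<Psi>" for u
    using that part by (auto simp: partition_on_def)
  have Hsv: "single_valued (parcs H)"
  proof (rule single_valuedI)
    fix u v w assume uv: "(u, v) \<in> parcs H" "(u, w) \<in> parcs H"
    then obtain X where X: "X \<in> P" "u \<in> X" using Hwf block by (auto simp: H_def)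
    show "v = w" by (rule f_sv[OF X(1) HX[OF uv(1) X(2,1)] HX[OF uv(2) X(2,1)]])
  qed
  have edge: "(X, Z) \<in> parcs F' \<or> X = Z \<and> (u, v) \<in> parcs (S X)"
    if uv: "(u, v) \<in> parcs H" and X: "u \<in> X" "X \<in> P" and Z: "v \<in> Z" "Z \<in> P" for u v X Z
    using f_arc[OF X(2) HX[OF uv X]]
  proof (elim conjE disjE exE)
    assume "(u, v) \<in> parcs (S X)"
    with Sarcs(1)[OF X(2)] have "v \<in> X" by blast
    with X Z have "X = Z" by (intro block_unique)
    with \<open>(u, v) \<in> parcs (S X)\<close> show ?thesis by simp
  next
    fix Y assume Y: "(X, Y) \<in> parcs F'" "v \<in> Y"
    with Z have "Y = Z" by (intro block_unique[OF arc'D(2)[OF Y(1)]])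
    with Y show ?thesis by simp
  qed
  \<comment> \<open>A path of \<open>H\<close> either stays inside the tree of one block or projects to a nonempty path of
    \<open>F'\<close>; hence a cycle of \<open>H\<close> would give a cycle of a block tree or of \<open>F'\<close>.\<close>
  have path: "\<forall>Z\<in>P. w \<in> Z \<longrightarrow> (X, Z) \<in> (parcs F')\<^sup>+ \<or> X = Z \<and> (u, w) \<in> (parcs (S X))\<^sup>+"
    if "(u, w) \<in> (parcs H)\<^sup>+" "X \<in> P" "u \<in> X" for u w X
    using that(1)
  proof induction
    case (base v)
    then show ?case using edge[OF base that(3,2)] by blast
  next
    case (step v w)
    obtain Y where Y: "v \<in> Y" "Y \<in> P" using step(2) Hwf block by (auto simp: H_def)
    with step.IH have IH: "(X, Y) \<in> (parcs F')\<^sup>+ \<or> X = Y \<and> (u, v) \<in> (parcs (S X))\<^sup>+" by blast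
    show ?case
    proof (intro ballI impI)
      fix Z assume Z: "Z \<in> P" "w \<in> Z"
      from IH edge[OF step(2) Y Z(2,1)]
      show "(X, Z) \<in> (parcs F')\<^sup>+ \<or> X = Z \<and> (u, w) \<in> (parcs (S X))\<^sup>+"
        by (auto intro: trancl_into_trancl)
    qed
  qed
  have Hac: "acyclic (parcs H)"
    unfolding acyclic_def
  proof (intro allI notI)
    fix u assume u: "(u, u) \<in> (parcs H)\<^sup>+"
    then obtain v where "(u, v) \<in> parcs H" by (meson converse_tranclE)
    then obtain X where X: "X \<in> P" "u \<in> X" using Hwf block by (auto simp: H_def)
    with path[OF u X] have "(X, X) \<in> (parcs F')\<^sup>+ \<or> (u, u) \<in> (parcs (S X))\<^sup>+" by blast
    then show False
      using forest' Sarcs(3)[OF X(1)] by (auto simp: entering_forest_iff acyclic_def)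
  qed
  have HF: "entering_forest H"
    using fin Hwf Hsv Hac by (auto simp: entering_forest_iff pair_fin_digraph_iff H_def)
  \<comment> \<open>The chosen tree survives in \<open>H\<close>. This gives tree-divisibility and
    supplies the root at which \<open>splitting_forest_arc_iff\<close> reads off the splitting of
    \<open>H\<close>.\<close>
  have SH: "S X \<in> trees_root H X (x X)" if "X \<in> P" for X
    using SX[OF that] Sf[OF that] fH[OF that] block_subset[OF that] Hwf Sarcs(1)[OF that]
    by (auto simp: mem_trees_root_iff subgraph_with_proj_iff pair_wf_digraph_iff H_def)
  have partH: "partition_on (pverts H) P" using part by (simp add: H_def)
  have "(X, Y) \<in> parcs F' \<longleftrightarrow> (X, Y) \<in> parcs (splitting H P)" if X: "X \<in> P" for X Y
    unfolding splitting_forest_arc_iff[OF HF partH X SH[OF X]]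
  proof
    assume XY: "(X, Y) \<in> parcs F'"
    \<comment> \<open>As \<open>F'\<close> has at most one arc leaving \<open>X\<close>, the target
      block provided by \<open>fS\<close> is \<open>Y\<close>.\<close>
    with fS[OF X] obtain y where "y \<in> Y" "(x X, y) \<in> f X" using arc'_unique by blast
    with XY fH[OF X] show "Y \<in> P \<and> X \<noteq> Y \<and> (\<exists>y\<in>Y. (x X, y) \<in> parcs H)" using arc'D by blast
  next
    assume "Y \<in> P \<and> X \<noteq> Y \<and> (\<exists>y\<in>Y. (x X, y) \<in> parcs H)"
    then obtain y where y: "Y \<in> P" "y \<in> Y" "(x X, y) \<in> parcs H" by blast
    from f_arc[OF X HX[OF y(3) xX(1)[OF X] X]] xX(2)[OF X]
    obtain Z where "(X, Z) \<in> parcs F'" "y \<in> Z" by blast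
    with y show "(X, Y) \<in> parcs F'" using block_unique arc'D by metis
  qed
  moreover have "X \<in> P" if "(X, Y) \<in> parcs F' \<or> (X, Y) \<in> parcs (splitting H P)" for X Y
    using that arc'D by (auto simp: splitting_def)
  ultimately have "parcs F' = parcs (splitting H P)" by auto
  moreover have "tree_divisible H P" 
    using SH unfolding tree_divisible_def ex_in_conv[symmetric] mem_trees_iff by blast
  ultimately show "is_principal \<Psi> P F' H" using HF H\<Psi> by (simp add: is_principal_iff H_def)
qed

section \<open>Minimality as a condition on each single block\<close>

lemma Upsilon_principal:
  assumes "is_principal \<Psi> P F' F"
  shows "Upsilon \<psi> F = (\<Sum>X\<in>P. sum \<psi> (tail_arcs F X))"
  using assms part by (intro Upsilon_eq_sum_blocks)
    (auto simp: is_principal_iff entering_forest_iff pair_fin_digraph_iff)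

text \<open>Forwards, exchanging the arcs of one block gives another principal, and the terms of all
  other blocks cancel in the comparison. Backwards, the inequalities of the blocks are added
  up.\<close>

lemma minimal_principal_iff_blocks:
  assumes F: "is_principal \<Psi> P F' F"
  shows "minimal_principal \<psi> \<Psi> P F' F \<longleftrightarrow>
    (\<forall>X\<in>P. \<forall>A\<in>block_arcs X. sum \<psi> (tail_arcs F X) \<le> sum \<psi> A)"
proof
  assume min: "minimal_principal \<psi> \<Psi> P F' F"
  show "\<forall>X\<in>P. \<forall>A\<in>block_arcs X. sum \<psi> (tail_arcs F X) \<le> sum \<psi> A"
  proof (intro ballI)
    fix X A assume X: "X \<in> P" and A: "A \<in> block_arcs X"
    let ?f = "(tail_arcs F)(X := A)"
    let ?H = "\<lparr>pverts = pverts \<Psi>, parcs = (\<Union>X\<in>P. ?f X)\<rparr>"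
    have f: "?f Z \<in> block_arcs Z" if "Z \<in> P" for Z
      using that A tail_arcs_principal[OF F that] by simp
    have H: "is_principal \<Psi> P F' ?H" by (rule principal_of_blocks(1)[OF f])
    have finP: "finite P" using fin finite_elements[OF _ part] by (simp add: pair_fin_digraph_iff)
    have "(\<Sum>Z\<in>P. sum \<psi> (tail_arcs F Z)) \<le> (\<Sum>Z\<in>P. sum \<psi> (tail_arcs ?H Z))"
      using min H Upsilon_principal[OF F] Upsilon_principal[OF H]
      by (metis minimal_principal_def)
    also have "\<dots> = (\<Sum>Z\<in>P. sum \<psi> (?f Z))"
      using principal_of_blocks(2)[OF f] by (intro sum.cong) auto
    also have "\<dots> = sum \<psi> A + (\<Sum>Z\<in>P - {X}. sum \<psi> (tail_arcs F Z))"
      using X finP by (simp add: sum.remove[of P X])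
    finally show "sum \<psi> (tail_arcs F X) \<le> sum \<psi> A"
      using X finP by (simp add: sum.remove[of P X])
  qed
next
  assume "\<forall>X\<in>P. \<forall>A\<in>block_arcs X. sum \<psi> (tail_arcs F X) \<le> sum \<psi> A"
  then show "minimal_principal \<psi> \<Psi> P F' F"
    using F tail_arcs_principal
    by (auto simp: minimal_principal_def Upsilon_principal intro!: sum_mono)
qed

text \<open>At a root of \<open>F'\<close> the admissible arc sets are those of the trees on
  \<open>X\<close>, the very family over which \<open>lambda_tree\<close> is minimised.\<close>

lemma minimal_block_root_iff:
  assumes F: "is_principal \<Psi> P F' F" and X: "X \<in> P" "X \<notin> Domain (parcs F')"
  shows "ereal (Upsilon_on \<psi> F X) = lambda_tree \<psi> \<Psi> X \<longleftrightarrow>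
    (\<forall>A\<in>block_arcs X. sum \<psi> (tail_arcs F X) \<le> sum \<psi> A)"
proof -
  have blocks: "block_arcs X = parcs ` trees \<Psi> X" using X(2) by (auto simp: block_arcs_def)
  then obtain T where T: "T \<in> trees \<Psi> X" "tail_arcs F X = parcs T"
    using tail_arcs_principal[OF F X(1)] by auto
  have U: "Upsilon \<psi> S = sum \<psi> (parcs S)" if "S \<in> trees \<Psi> X" for S
    using that by (auto simp: mem_trees_iff mem_trees_root_iff subgraph_with_proj_iff intro: Upsilon_eq)
  have "Upsilon_on \<psi> F X = Upsilon \<psi> T" using T U by (simp add: Upsilon_on_eq)
  then show ?thesis using ereal_eq_INF_iff[OF T(1), of "Upsilon \<psi>"] T U
    by (simp add: lambda_tree_eq blocks)
qed

text \<open>\<open>Y\<close> is the only target of \<open>X\<close> in \<open>F'\<close>, so the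
  admissible arc sets are those of the family defining \<open>lambda_between\<close>.\<close>

lemma minimal_block_arc_iff:
  assumes F: "is_principal \<Psi> P F' F" and XY: "(X, Y) \<in> parcs F'"
  shows "ereal (Upsilon_on \<psi> F X) = lambda_between \<psi> \<Psi> X Y \<longleftrightarrow>
    (\<forall>A\<in>block_arcs X. sum \<psi> (tail_arcs F X) \<le> sum \<psi> A)"
proof -
  have blocks: "block_arcs X = parcs ` trees_between \<Psi> X Y"
  proof -
    have "(X, Z) \<in> parcs F' \<longleftrightarrow> Z = Y" for Z using XY arc'_unique by blast
    then show ?thesis using XY by (auto simp: block_arcs_def)
  qed
  then obtain T where T: "T \<in> trees_between \<Psi> X Y" "tail_arcs F X = parcs T"
    using tail_arcs_principal[OF F arc'D(1)[OF XY]] by auto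
  have U: "Upsilon \<psi> S = sum \<psi> (parcs S)" if "S \<in> trees_between \<Psi> X Y" for S
    using that by (auto simp: trees_between_def trees_out_def subgraph_with_proj_iff intro: Upsilon_eq)
  have "Upsilon_on \<psi> F X = Upsilon \<psi> T" using T U by (simp add: Upsilon_on_eq)
  then show ?thesis using ereal_eq_INF_iff[OF T(1), of "Upsilon \<psi>"] T U
    by (simp add: lambda_between_def blocks)
qed

text \<open>Another tree on \<open>X\<close> with the same root can take over the outgoing arc, if
  there is one, so it competes with the arcs of \<open>F\<close> at \<open>X\<close>.\<close>

lemma minimal_block_imp_minimal_tree:
  assumes F: "is_principal \<Psi> P F' F" and X: "X \<in> P"
    and min: "\<And>A. A \<in> block_arcs X \<Longrightarrow> sum \<psi> (tail_arcs F X) \<le> sum \<psi> A"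
  shows "ereal (Upsilon \<psi> (pinduce F X)) = lambda_root \<psi> \<Psi> X (tree_root (pinduce F X))"
proof -
  have le: "ereal (Upsilon \<psi> (pinduce F X)) = lambda_root \<psi> \<Psi> X (tree_root (pinduce F X))"
    if x: "pinduce F X \<in> trees_root \<Psi> X x"
      and *: "\<And>S. S \<in> trees_root \<Psi> X x \<Longrightarrow> sum \<psi> (parcs (pinduce F X)) \<le> sum \<psi> (parcs S)" for x
  proof -
    have U: "Upsilon \<psi> S = sum \<psi> (parcs S)" if "S \<in> trees_root \<Psi> X x" for S
      using that by (auto simp: mem_trees_root_iff subgraph_with_proj_iff intro: Upsilon_eq)
    have "tree_root (pinduce F X) = x" using x by (simp add: mem_trees_root_iff tree_root_eq)
    then show ?thesis using ereal_eq_INF_iff[OF x, of "Upsilon \<psi>"] * U x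
      by (simp add: lambda_root_def)
  qed
  show ?thesis using F X
  proof (cases rule: principal_block)
    case (1 x)
    show ?thesis
    proof (rule le[OF 1(1)])
      fix S assume "S \<in> trees_root \<Psi> X x"
      with 1(2) have "parcs S \<in> block_arcs X" unfolding mem_block_arcs_iff by blast
      with min 1(4) show "sum \<psi> (parcs (pinduce F X)) \<le> sum \<psi> (parcs S)" by metis
    qed
  next
    case (2 x Y y)
    \<comment> \<open>The root \<open>x\<close> has no outgoing arc in \<open>S\<close>, so the arc
      to \<open>y\<close> is new and contributes \<open>\<psi> (x, y)\<close> for every
      \<open>S\<close>; this common term cancels below.\<close>
    have sum_insert: "sum \<psi> (insert (x, y) (parcs S)) = \<psi> (x, y) + sum \<psi> (parcs S)"
      if "S \<in> trees_root \<Psi> X x" for S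
    proof -
      have "x \<in> roots S" using that by (simp add: mem_trees_root_iff)
      then have "(x, y) \<notin> parcs S" by (auto simp: roots_eq)
      moreover have "finite (parcs S)"
        using that by (auto simp: mem_trees_root_iff entering_forest_iff intro: finite_subset)
      ultimately show ?thesis by simp
    qed
    show ?thesis
    proof (rule le[OF 2(1)])
      fix S assume S: "S \<in> trees_root \<Psi> X x"
      with 2 have "insert (x, y) (parcs S) \<in> block_arcs X" unfolding mem_block_arcs_iff by blast
      from min[OF this] show "sum \<psi> (parcs (pinduce F X)) \<le> sum \<psi> (parcs S)"
        using sum_insert[OF S] sum_insert[OF 2(1)] 2(6) by simp
    qed
  qed
qed

text \<open>Translates the condition in (i), which speaks of roots of \<open>F\<close>, into one on
  \<open>F'\<close> alone.\<close>

lemma block_has_root_iff: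
  assumes "is_principal \<Psi> P F' F" "X \<in> P"
  shows "X \<inter> roots F \<noteq> {} \<longleftrightarrow> X \<notin> Domain (parcs F')"
  using assms
proof (cases rule: principal_block)
  case (1 x)
  have "x \<in> roots (pinduce F X)" using 1(1) by (simp add: mem_trees_root_iff)
  then have "x \<in> X" by (simp add: roots_eq pinduce_def)
  with 1 show ?thesis by blast
qed blast

end

theorem theorem1:
  fixes \<Psi> :: "'a pair_pre_digraph"
    and \<psi> :: "('a \<times> 'a) weight_fun"
    and P :: "'a set set"
    and F' :: "'a set pair_pre_digraph"
    and F :: "'a pair_pre_digraph"
    and k :: nat
  assumes "pair_fin_digraph \<Psi>"
    and "partition_on (pverts \<Psi>) P"
    and "tree_divisible \<Psi> P"
    and "F' \<in> spanning_forests k (splitting \<Psi> P)"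
    and "is_principal \<Psi> P F' F"
  shows "minimal_principal \<psi> \<Psi> P F' F \<longleftrightarrow>
    (\<forall>Z \<in> P. Z \<inter> roots F \<noteq> {} \<longrightarrow> ereal (Upsilon_on \<psi> F Z) = lambda_tree \<psi> \<Psi> Z) \<and>
    (\<forall>(X, Y) \<in> parcs F'. ereal (Upsilon_on \<psi> F X) = lambda_between \<psi> \<Psi> X Y) \<and>
    (\<forall>X \<in> P. ereal (Upsilon \<psi> (pinduce F X)) = lambda_root \<psi> \<Psi> X (tree_root (pinduce F X)))"
    (is "_ \<longleftrightarrow> ?i \<and> ?ii \<and> ?iii")
proof -
  interpret divided_digraph \<Psi> P F'
  proof (rule divided_digraph.intro)
    have F': "entering_forest F'" "pverts F' = pverts (splitting \<Psi> P)"
      "parcs F' \<subseteq> parcs (splitting \<Psi> P)"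
      using assms(4) by (simp_all add: spanning_forests_def spanning_def subgraph_with_proj_iff)
    show "entering_forest F'" "parcs F' \<subseteq> parcs (splitting \<Psi> P)" by fact+
    show "pverts F' = P" using F'(2) by (simp add: splitting_def)
  qed fact+
  note F = assms(5)
  let ?min = "\<lambda>X. \<forall>A\<in>block_arcs X. sum \<psi> (tail_arcs F X) \<le> sum \<psi> A"
  \<comment> \<open>Conditions (i) and (ii) divide the blocks between them: roots of
    \<open>F'\<close> on one side, blocks with an outgoing arc in \<open>F'\<close> on the other.
    Together they express minimality in every block, from which (iii) is derived.\<close>
  have i: "?i \<longleftrightarrow> (\<forall>X\<in>P. X \<notin> Domain (parcs F') \<longrightarrow> ?min X)"
    using block_has_root_iff[OF F] minimal_block_root_iff[OF F] by simp
  have ii: "?ii \<longleftrightarrow> (\<forall>X\<in>P. X \<in> Domain (parcs F') \<longrightarrow> ?min X)"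
    using minimal_block_arc_iff[OF F] arc'D(1) by blast
  have "?iii" if "\<forall>X\<in>P. ?min X"
    using that minimal_block_imp_minimal_tree[OF F] by blast
  moreover have "?i \<and> ?ii \<longleftrightarrow> (\<forall>X\<in>P. ?min X)" unfolding i ii by blast
  ultimately show ?thesis unfolding minimal_principal_iff_blocks[OF F] by argo
qed

end
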